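(* Let $n\ge 2$ be an integer. For every integer $m\in\{n+1,\dots,2n-1\}$ there is a graph $G$ such that $\nu(H)=n$ and $\gamma(H)=m$ for every $H\in\Gamma_1(G)$.
   Context: A hypergraph $H$ has a finite non-empty vertex set and a collection of non-empty subsets (hyperedges); rank is the maximum hyperedge size. Two vertices are adjacent if some hyperedge contains both. $\nu(H)$ is the maximum number of pairwise disjoint hyperedges; $\gamma(H)$ is the minimum size of a set $D$ of vertices such that every vertex not in $D$ is adjacent to a vertex of $D$. Dilation of a simple graph $G$: for $k\ge 3$, assign to each vertex $v$ a positive integer $s_v$ with $s_u+s_v\le k$ for every edge $uv$; for each vertex $v$ let $\mathbf v$ be an $s_v$-set containing $v$, and for each edge $e=uv$ let $\mathbf e$ be a set of size at most $k-s_u-s_v$, all these sets pairwise disjoint. A dilation of $G$ is a hypergraph of rank $k$ with vertex set $\bigcup_v\mathbf v\cup\bigcup_e\mathbf e$ and hyperedges $\mathbf u\cup\mathbf v\cup\mathbf e$ for $e=uv\in E(G)$. $\Gamma_1(G)$ is the set of dilations of $G$ with $\mathbf e\neq\emptyset$ for every edge $e$. *)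

theory Defs
  imports Main "HOL-Library.Disjoint_Sets" "HOL-Library.Infinite_Typeclass"
begin

record 'a hgraph =
  verts :: "'a set"
  edges :: "'a set set"

definition hypergraph :: "'a hgraph \<Rightarrow> bool" where
  "hypergraph H \<longleftrightarrow> finite (verts H) \<and> verts H \<noteq> {} \<and> (\<forall>e\<in>edges H. e \<noteq> {} \<and> e \<subseteq> verts H)"

definition simple_graph :: "'a hgraph \<Rightarrow> bool" where
  "simple_graph G \<longleftrightarrow> hypergraph G \<and> (\<forall>e\<in>edges G. card e = 2)"

text \<open>The value is meaningful only for a hypergraph with at least one hyperedge.\<close>

definition hrank :: "'a hgraph \<Rightarrow> nat" where
  "hrank H = Max (card ` edges H)"

definition adjacent :: "'a hgraph \<Rightarrow> 'a \<Rightarrow> 'a \<Rightarrow> bool" where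
  "adjacent H x y \<longleftrightarrow> x \<noteq> y \<and> (\<exists>e\<in>edges H. x \<in> e \<and> y \<in> e)"

definition matching :: "'a hgraph \<Rightarrow> 'a set set \<Rightarrow> bool" where
  "matching H M \<longleftrightarrow> M \<subseteq> edges H \<and> disjoint M"

definition matching_number :: "'a hgraph \<Rightarrow> nat" where
  "matching_number H = Max {card M |M. matching H M}"

definition dominating :: "'a hgraph \<Rightarrow> 'a set \<Rightarrow> bool" where
  "dominating H D \<longleftrightarrow> D \<subseteq> verts H \<and> (\<forall>x\<in>verts H - D. \<exists>y\<in>D. adjacent H x y)"

definition domination_number :: "'a hgraph \<Rightarrow> nat" where
  "domination_number H = Min {card D |D. dominating H D}"

text \<open>
  \<open>S v\<close> is the set that replaces the vertex \<open>v\<close>, of size \<open>s v\<close>, and \<open>T e\<close> is the set added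
  to the edge \<open>e\<close>. Disjointness is that of indexed families, so several of the sets \<open>T e\<close> may be
  empty. The last conjunct says that the rank is exactly \<open>k\<close>, not merely at most \<open>k\<close>.
\<close>

definition dilation_via ::
  "nat \<Rightarrow> 'a hgraph \<Rightarrow> ('a \<Rightarrow> nat) \<Rightarrow> ('a \<Rightarrow> 'a set) \<Rightarrow> ('a set \<Rightarrow> 'a set) \<Rightarrow> 'a hgraph \<Rightarrow> bool" where
  "dilation_via k G s S T H \<longleftrightarrow>
     3 \<le> k \<and>
     (\<forall>v\<in>verts G. 0 < s v) \<and>
     (\<forall>u v. {u, v} \<in> edges G \<longrightarrow> s u + s v \<le> k) \<and>
     (\<forall>v\<in>verts G. finite (S v) \<and> card (S v) = s v \<and> v \<in> S v) \<and>
     (\<forall>u v. {u, v} \<in> edges G \<longrightarrow>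
        finite (T {u, v}) \<and> card (T {u, v}) \<le> k - s u - s v) \<and>
     disjoint_family_on S (verts G) \<and>
     disjoint_family_on T (edges G) \<and>
     (\<forall>v\<in>verts G. \<forall>e\<in>edges G. S v \<inter> T e = {}) \<and>
     H = \<lparr>verts = (\<Union>v\<in>verts G. S v) \<union> (\<Union>e\<in>edges G. T e),
          edges = {S u \<union> S v \<union> T {u, v} |u v. {u, v} \<in> edges G}\<rparr> \<and>
     hrank H = k"

text \<open>The rank \<open>k\<close> is not fixed: dilations of all ranks are collected.\<close>

definition Gamma1 :: "'a hgraph \<Rightarrow> 'a hgraph set" where
  "Gamma1 G = {H. \<exists>k s S T. dilation_via k G s S T H \<and> (\<forall>e\<in>edges G. T e \<noteq> {})}"

end

theory Submission
  imports Defs "HOL-Library.Nat_Bijection"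
begin

text \<open>
  A point of \<open>T e\<close> is adjacent only to points of the hyperedge made from \<open>e\<close>, so a dominating set
  of a dilation must meet every hyperedge; replacing each of its points by a vertex of \<open>G\<close> turns it
  into a vertex cover of \<open>G\<close>. Hence, in the absence of isolated vertices, every \<open>H\<close> in
  \<open>\<Gamma>\<^sub>1(G)\<close> has the matching number of \<open>G\<close>, and its domination number is the vertex cover number of
  \<open>G\<close>. A triangle has matching number 1 and cover number 2, a single edge has 1 and 1, so \<open>m - n\<close>
  triangles together with \<open>2 * n - m\<close> single edges will do.
\<close>

definition vertex_cover :: "'a hgraph \<Rightarrow> 'a set \<Rightarrow> bool" where
  "vertex_cover G C \<longleftrightarrow> C \<subseteq> verts G \<and> (\<forall>e\<in>edges G. C \<inter> e \<noteq> {})"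

section \<open>Matchings and domination in a dilation of a fixed graph\<close>

locale dilation =
  fixes k :: nat and G :: "'a hgraph" and s S T H
  assumes graph: "simple_graph G"
    and no_isolated: "\<And>v. v \<in> verts G \<Longrightarrow> \<exists>e\<in>edges G. v \<in> e"
    and via: "dilation_via k G s S T H"
    and T_nonempty: "\<And>e. e \<in> edges G \<Longrightarrow> T e \<noteq> {}"
begin

text \<open>The hyperedge built from \<open>e\<close>, written as a function of the edge itself
  rather than of an ordered pair of endpoints, so that \<open>edges H\<close> becomes an image of
  \<open>edges G\<close>.\<close>

definition dilated :: "'a set \<Rightarrow> 'a set" where
  "dilated e = (\<Union>v\<in>e. S v) \<union> T e"

lemma edge_subset: "e \<in> edges G \<Longrightarrow> e \<subseteq> verts G"
  using graph by (auto simp: simple_graph_def hypergraph_def)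

lemma edgeE:
  assumes "e \<in> edges G"
  obtains u v where "e = {u, v}" "u \<noteq> v"
  using graph assms by (metis simple_graph_def card_2_iff)

lemma in_S: "v \<in> verts G \<Longrightarrow> v \<in> S v"
  using via by (simp add: dilation_via_def)

lemma S_eq: "x \<in> S u \<Longrightarrow> x \<in> S v \<Longrightarrow> u \<in> verts G \<Longrightarrow> v \<in> verts G \<Longrightarrow> u = v"
proof -
  have "disjoint_family_on S (verts G)" using via by (simp add: dilation_via_def)
  then show "x \<in> S u \<Longrightarrow> x \<in> S v \<Longrightarrow> u \<in> verts G \<Longrightarrow> v \<in> verts G \<Longrightarrow> u = v"
    unfolding disjoint_family_on_def by blast
qed

lemma T_eq: "x \<in> T e \<Longrightarrow> x \<in> T f \<Longrightarrow> e \<in> edges G \<Longrightarrow> f \<in> edges G \<Longrightarrow> e = f"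
proof -
  have "disjoint_family_on T (edges G)" using via by (simp add: dilation_via_def)
  then show "x \<in> T e \<Longrightarrow> x \<in> T f \<Longrightarrow> e \<in> edges G \<Longrightarrow> f \<in> edges G \<Longrightarrow> e = f"
    unfolding disjoint_family_on_def by blast
qed

lemma S_T: "x \<in> S v \<Longrightarrow> x \<in> T e \<Longrightarrow> v \<in> verts G \<Longrightarrow> e \<in> edges G \<Longrightarrow> False"
proof -
  have "\<forall>v\<in>verts G. \<forall>e\<in>edges G. S v \<inter> T e = {}" using via by (simp add: dilation_via_def)
  then show "x \<in> S v \<Longrightarrow> x \<in> T e \<Longrightarrow> v \<in> verts G \<Longrightarrow> e \<in> edges G \<Longrightarrow> False"
    by blast
qed

lemma verts_H: "verts H = (\<Union>v\<in>verts G. S v) \<union> (\<Union>e\<in>edges G. T e)"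
  using via by (simp add: dilation_via_def)

lemma edges_H: "edges H = dilated ` edges G"
proof -
  have "edges H = {S u \<union> S v \<union> T {u, v} |u v. {u, v} \<in> edges G}"
    using via by (simp add: dilation_via_def)
  also have "\<dots> = dilated ` edges G"
  proof (intro set_eqI iffI)
    fix x assume "x \<in> {S u \<union> S v \<union> T {u, v} |u v. {u, v} \<in> edges G}"
    then obtain u v where "x = S u \<union> S v \<union> T {u, v}" "{u, v} \<in> edges G" by blast
    then show "x \<in> dilated ` edges G"
      by (intro image_eqI[of _ _ "{u, v}"]) (auto simp: dilated_def)
  next
    fix x assume "x \<in> dilated ` edges G"
    then obtain e where e: "e \<in> edges G" "x = dilated e" by blast
    from e(1) obtain u v where "e = {u, v}" by (rule edgeE)
    with e show "x \<in> {S u \<union> S v \<union> T {u, v} |u v. {u, v} \<in> edges G}"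
      by (auto simp: dilated_def)
  qed
  finally show ?thesis .
qed

lemma finite_verts_G: "finite (verts G)"
  using graph by (simp add: simple_graph_def hypergraph_def)

lemma finite_edges_G: "finite (edges G)"
  by (rule finite_subset[of _ "Pow (verts G)"]) (use edge_subset finite_verts_G in auto)

lemma finite_verts_H: "finite (verts H)"
proof -
  have "finite (T e)" if "e \<in> edges G" for e
  proof -
    from that obtain u v where "e = {u, v}" by (rule edgeE)
    with that via show ?thesis by (auto simp: dilation_via_def)
  qed
  moreover have "finite (S v)" if "v \<in> verts G" for v
    using via that by (simp add: dilation_via_def)
  ultimately show ?thesis
    by (simp add: verts_H finite_verts_G finite_edges_G)
qed

text \<open>\<open>T e\<close> avoids every \<open>S v\<close> and every other \<open>T f\<close>,
  so its points are private to the hyperedge of \<open>e\<close>. Both injectivity of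
  \<open>dilated\<close> and the passage from domination to covering rest on this.\<close>

lemma T_in_dilated:
  assumes "x \<in> T e" "x \<in> dilated f" "e \<in> edges G" "f \<in> edges G"
  shows "e = f"
  using assms S_T[of x _ e] T_eq[of x e f] edge_subset[of f] by (auto simp: dilated_def)

lemma inj_on_dilated: "inj_on dilated (edges G)"
proof (rule inj_onI)
  fix e f assume ef: "e \<in> edges G" "f \<in> edges G" "dilated e = dilated f"
  then obtain x where x: "x \<in> T e" using T_nonempty by blast
  then have "x \<in> dilated f" using ef by (auto simp: dilated_def)
  with x ef show "e = f" using T_in_dilated by metis
qed

text \<open>Private points are not shared by two distinct hyperedges, so a common point lies in some
  \<open>S v\<close> with \<open>v\<close> a common endpoint. Conversely a common endpoint
  \<open>v\<close> is itself a common point, since \<open>v \<in> S v\<close>.\<close>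

lemma dilated_disjoint_iff:
  assumes "e \<in> edges G" "f \<in> edges G" "e \<noteq> f"
  shows "dilated e \<inter> dilated f = {} \<longleftrightarrow> e \<inter> f = {}"
proof
  assume *: "dilated e \<inter> dilated f = {}"
  show "e \<inter> f = {}"
  proof (rule ccontr)
    assume "e \<inter> f \<noteq> {}"
    then obtain v where v: "v \<in> e" "v \<in> f" by blast
    then have "v \<in> S v" using assms edge_subset in_S by blast
    with v have "v \<in> dilated e \<inter> dilated f" by (auto simp: dilated_def)
    with * show False by blast
  qed
next
  assume *: "e \<inter> f = {}"
  show "dilated e \<inter> dilated f = {}"
  proof (rule ccontr)
    assume "dilated e \<inter> dilated f \<noteq> {}"
    then obtain x where x: "x \<in> dilated e" "x \<in> dilated f" by blast
    have "x \<notin> T e" "x \<notin> T f"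
      using x assms T_in_dilated by blast+
    with x obtain u v where uv: "u \<in> e" "v \<in> f" "x \<in> S u" "x \<in> S v"
      by (auto simp: dilated_def)
    then have "u = v" using assms edge_subset S_eq by blast
    with uv * show False by blast
  qed
qed

text \<open>On edges of \<open>G\<close>, \<open>dilated\<close> preserves and reflects both
  equality and disjointness, hence also pairwise disjointness of a family.\<close>

lemma matching_dilated_iff:
  assumes "M \<subseteq> edges G"
  shows "matching H (dilated ` M) \<longleftrightarrow> matching G M"
proof -
  have "disjoint (dilated ` M) \<longleftrightarrow> (\<forall>e\<in>M. \<forall>f\<in>M. dilated e \<noteq> dilated f \<longrightarrow> dilated e \<inter> dilated f = {})"
    by (simp add: disjoint_def)
  also have "\<dots> \<longleftrightarrow> (\<forall>e\<in>M. \<forall>f\<in>M. e \<noteq> f \<longrightarrow> e \<inter> f = {})"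
  proof (intro ball_cong refl)
    fix e f assume "e \<in> M" "f \<in> M"
    with assms have ef: "e \<in> edges G" "f \<in> edges G" by blast+
    then have "dilated e = dilated f \<longleftrightarrow> e = f"
      using inj_on_dilated by (simp add: inj_on_eq_iff)
    then show "(dilated e \<noteq> dilated f \<longrightarrow> dilated e \<inter> dilated f = {}) \<longleftrightarrow> (e \<noteq> f \<longrightarrow> e \<inter> f = {})"
      using dilated_disjoint_iff[OF ef] by blast
  qed
  finally have "disjoint (dilated ` M) \<longleftrightarrow> disjoint M"
    by (simp add: disjoint_def)
  with assms show ?thesis by (auto simp: matching_def edges_H)
qed

lemma matching_number_eq: "matching_number H = matching_number G"
proof -
  have "{card M |M. matching H M} = {card M |M. matching G M}"
  proof (intro set_eqI iffI)
    fix c assume "c \<in> {card M |M. matching H M}"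
    then obtain M where M: "matching H M" "c = card M" by blast
    then obtain N where N: "N \<subseteq> edges G" "M = dilated ` N"
      by (auto simp: matching_def edges_H subset_image_iff)
    with M have "matching G N" using matching_dilated_iff by blast
    moreover have "c = card N"
      using M N inj_on_dilated by (auto intro: card_image inj_on_subset)
    ultimately show "c \<in> {card M |M. matching G M}" by blast
  next
    fix c assume "c \<in> {card M |M. matching G M}"
    then obtain M where M: "matching G M" "c = card M" by blast
    then have sub: "M \<subseteq> edges G" by (simp add: matching_def)
    with M have "matching H (dilated ` M)" using matching_dilated_iff by blast
    moreover have "c = card (dilated ` M)"
      using M sub inj_on_dilated by (auto intro: card_image[symmetric] inj_on_subset)
    ultimately show "c \<in> {card M |M. matching H M}" by blast
  qed
  then show ?thesis by (simp add: matching_number_def)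
qed

text \<open>A cover of \<open>G\<close> meets every hyperedge, because each vertex belongs to its
  own block; and every point of \<open>H\<close> lies in some hyperedge.\<close>

lemma dominating_vertex_cover:
  assumes "vertex_cover G C"
  shows "dominating H C"
  unfolding dominating_def
proof (intro conjI ballI)
  show "C \<subseteq> verts H"
    using assms in_S by (auto simp: vertex_cover_def verts_H)
  fix x assume x: "x \<in> verts H - C"
  \<comment> \<open>For a point of some \<open>S v\<close>, an edge at \<open>v\<close> is taken,
    which exists because \<open>v\<close> is not isolated; a point of \<open>T e\<close> comes with
    its edge.\<close>
  then obtain e where e: "e \<in> edges G" "x \<in> dilated e"
    using no_isolated by (fastforce simp: verts_H dilated_def)
  then obtain c where c: "c \<in> C" "c \<in> e" using assms by (auto simp: vertex_cover_def)
  then have "c \<in> dilated e"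
    using e edge_subset in_S by (auto simp: dilated_def)
  with x c e show "\<exists>y\<in>C. adjacent H x y"
    by (auto simp: adjacent_def edges_H intro!: bexI[of _ c])
qed

text \<open>Each point of \<open>D\<close> is exchanged for one vertex of \<open>G\<close> that
  covers at least as much; the image of \<open>D\<close> can only be smaller.\<close>

lemma vertex_cover_of_dominating:
  assumes D: "dominating H D"
  obtains C where "vertex_cover G C" "card C \<le> card D"
proof -
  \<comment> \<open>For \<open>x \<in> S v\<close> the vertex \<open>v\<close> works, since only
    edges at \<open>v\<close> have hyperedges through \<open>x\<close>. For
    \<open>x \<in> T e\<close> the only hyperedge through \<open>x\<close> is that of
    \<open>e\<close>, and either endpoint works.\<close>
  have "\<exists>v\<in>verts G. \<forall>e\<in>edges G. x \<in> dilated e \<longrightarrow> v \<in> e" if x: "x \<in> verts H" for x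
  proof (cases "\<exists>v\<in>verts G. x \<in> S v")
    case True
    then obtain v where v: "v \<in> verts G" "x \<in> S v" by blast
    have "v \<in> e" if e: "e \<in> edges G" "x \<in> dilated e" for e
    proof -
      have "x \<notin> T e" using v e(1) S_T by blast
      with e(2) obtain u where u: "u \<in> e" "x \<in> S u" by (auto simp: dilated_def)
      with v e(1) have "u = v" using S_eq edge_subset by blast
      with u show ?thesis by simp
    qed
    with v show ?thesis by blast
  next
    case False
    with x obtain e where e: "e \<in> edges G" "x \<in> T e" by (auto simp: verts_H)
    from e(1) obtain u v where "e = {u, v}" by (rule edgeE)
    then show ?thesis
      using e edge_subset T_in_dilated by blast
  qed
  then obtain p where p: "\<And>x. x \<in> verts H \<Longrightarrow> p x \<in> verts G"
      "\<And>x e. x \<in> verts H \<Longrightarrow> e \<in> edges G \<Longrightarrow> x \<in> dilated e \<Longrightarrow> p x \<in> e"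
    by metis
  have sub: "D \<subseteq> verts H" using D by (simp add: dominating_def)
  have "vertex_cover G (p ` D)"
    unfolding vertex_cover_def
  proof (intro conjI ballI)
    show "p ` D \<subseteq> verts G" using p(1) sub by blast
    fix e assume e: "e \<in> edges G"
    then obtain t where t: "t \<in> T e" using T_nonempty by blast
    \<comment> \<open>The private point \<open>t\<close> is either in \<open>D\<close> or has a
      neighbour in \<open>D\<close>; that neighbour shares a hyperedge with \<open>t\<close>, which
      must be the one of \<open>e\<close>.\<close>
    have "\<exists>y\<in>D. y \<in> dilated e"
    proof (cases "t \<in> D")
      case True
      with t show ?thesis by (auto simp: dilated_def)
    next
      case False
      moreover have "t \<in> verts H" using e t by (auto simp: verts_H)
      ultimately obtain y where y: "y \<in> D" "adjacent H t y"
        using D unfolding dominating_def by blast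
      then obtain f where f: "f \<in> edges G" "t \<in> dilated f" "y \<in> dilated f"
        unfolding adjacent_def edges_H by blast
      with e t have "e = f" using T_in_dilated by blast
      with y f show ?thesis by blast
    qed
    then obtain y where "y \<in> D" "y \<in> dilated e" by blast
    with e sub have "p y \<in> p ` D \<inter> e" using p(2) by blast
    then show "p ` D \<inter> e \<noteq> {}" by blast
  qed
  moreover have "card (p ` D) \<le> card D"
    using sub finite_verts_H by (meson card_image_le finite_subset)
  ultimately show thesis by (rule that)
qed

lemma domination_number_eq:
  assumes C: "vertex_cover G C" and min: "\<And>C'. vertex_cover G C' \<Longrightarrow> card C \<le> card C'"
  shows "domination_number H = card C"
  unfolding domination_number_def
proof (rule Min_eqI)
  show "finite {card D |D. dominating H D}"
    by (rule finite_subset[of _ "card ` Pow (verts H)"])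
      (use finite_verts_H in \<open>auto simp: dominating_def\<close>)
  show "card C \<in> {card D |D. dominating H D}"
    using C dominating_vertex_cover by blast
  fix c assume "c \<in> {card D |D. dominating H D}"
  then show "card C \<le> c"
    using vertex_cover_of_dominating min by (smt (verit) le_trans mem_Collect_eq)
qed

end

section \<open>Existence of dilations\<close>

text \<open>The rank 3 dilation that keeps each vertex as a singleton and adds one fresh point to
  each edge. The infinite type provides the fresh points.\<close>

lemma Gamma1_nonempty:
  fixes G :: "'a::infinite hgraph"
  assumes G: "simple_graph G" and ne: "edges G \<noteq> {}"
  shows "Gamma1 G \<noteq> {}"
proof -
  have fin: "finite (verts G)" and sub: "\<And>e. e \<in> edges G \<Longrightarrow> e \<subseteq> verts G"
    and c2: "\<And>e. e \<in> edges G \<Longrightarrow> card e = 2"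
    using G by (auto simp: simple_graph_def hypergraph_def)
  have "finite (edges G)"
    by (rule finite_subset[of _ "Pow (verts G)"]) (use sub fin in auto)
  moreover have "infinite (- verts G)"
    using fin infinite_UNIV by (metis finite_compl)
  ultimately obtain B where B: "finite B" "card B = card (edges G)" "B \<subseteq> - verts G"
    using infinite_arbitrarily_large by blast
  with \<open>finite (edges G)\<close> obtain g where g: "bij_betw g (edges G) B"
    by (metis finite_same_card_bij)
  have g_out: "g e \<notin> verts G" if "e \<in> edges G" for e
    using g B that by (auto simp: bij_betw_def)
  \<comment> \<open>The unions mirror the shape of the hyperedges in \<open>dilation_via\<close>,
    with singletons for \<open>S\<close> and \<open>T\<close>.\<close>
  define E where "E = {{u} \<union> {v} \<union> {g {u, v}} |u v. {u, v} \<in> edges G}"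
  define H where "H = \<lparr>verts = (\<Union>v\<in>verts G. {v}) \<union> (\<Union>e\<in>edges G. {g e}), edges = E\<rparr>"
  have "card x = 3" if "x \<in> E" for x
  proof -
    from that obtain u v where x: "x = {u, v, g {u, v}}" "{u, v} \<in> edges G"
      by (auto simp: E_def insert_commute)
    have "u \<noteq> v" using c2[OF x(2)] by auto
    moreover have "g {u, v} \<noteq> u" "g {u, v} \<noteq> v" using g_out[OF x(2)] sub[OF x(2)] by blast+
    ultimately show ?thesis by (simp add: x(1))
  qed
  moreover have "E \<noteq> {}"
  proof -
    from ne obtain e where e: "e \<in> edges G" by blast
    then obtain u v where "e = {u, v}" using c2 by (metis card_2_iff)
    with e show ?thesis by (auto simp: E_def)
  qed
  \<comment> \<open>Nonemptiness of \<open>E\<close> matters here: \<open>hrank\<close> is a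
    \<open>Max\<close>, and the rank has to be exactly 3.\<close>
  ultimately have "card ` E = {3}" by auto
  then have "hrank H = 3" by (simp add: hrank_def H_def)
  moreover have "disjoint_family_on (\<lambda>e. {g e}) (edges G)"
    using g by (auto simp: disjoint_family_on_def bij_betw_def inj_on_def)
  moreover have "disjoint_family_on (\<lambda>v. {v}) (verts G)"
    by (simp add: disjoint_family_on_def)
  moreover have "\<forall>v\<in>verts G. \<forall>e\<in>edges G. g e \<noteq> v"
    using g_out by blast
  ultimately have "dilation_via 3 G (\<lambda>_. 1) (\<lambda>v. {v}) (\<lambda>e. {g e}) H"
    unfolding dilation_via_def by (simp add: H_def E_def)
  then show ?thesis unfolding Gamma1_def by blast
qed

section \<open>Disjoint unions of edges and triangles\<close>

text \<open>Sizes 2 and 3 are exactly those for which a clique has an edge but no two disjoint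
  edges.\<close>

locale cliques =
  fixes I :: "'i set" and K :: "'i \<Rightarrow> 'a set"
  assumes fin_I: "finite I" and I_nonempty: "I \<noteq> {}"
    and disj: "disjoint_family_on K I"
    and card_K: "\<And>i. i \<in> I \<Longrightarrow> card (K i) \<in> {2, 3}"
begin

definition clique_graph :: "'a hgraph" where
  "clique_graph = \<lparr>verts = (\<Union>i\<in>I. K i), edges = {e. card e = 2 \<and> (\<exists>i\<in>I. e \<subseteq> K i)}\<rparr>"

lemma finite_K: "i \<in> I \<Longrightarrow> finite (K i)"
  using card_K by (metis card.infinite empty_iff insertE zero_neq_numeral)

lemma ex_pair:
  assumes "i \<in> I"
  shows "\<exists>x y. x \<noteq> y \<and> x \<in> K i \<and> y \<in> K i"
proof -
  have "2 \<le> card (K i)" using card_K[OF assms] by auto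
  then obtain B where "B \<subseteq> K i" "card B = 2"
    by (meson obtain_subset_with_card_n)
  then show ?thesis by (auto simp: card_2_iff)
qed

lemma simple_graph_cliques: "simple_graph clique_graph"
proof -
  obtain i where "i \<in> I" using I_nonempty by blast
  then have "(\<Union>i\<in>I. K i) \<noteq> {}" using ex_pair by blast
  then show ?thesis
    using finite_K fin_I by (auto simp: simple_graph_def hypergraph_def clique_graph_def)
qed

lemma cliques_no_isolated:
  assumes "v \<in> verts clique_graph"
  shows "\<exists>e\<in>edges clique_graph. v \<in> e"
proof -
  from assms obtain i where i: "i \<in> I" "v \<in> K i" by (auto simp: clique_graph_def)
  then obtain w where "w \<in> K i" "w \<noteq> v" using ex_pair by metis
  with i have "{v, w} \<in> edges clique_graph"
    by (auto simp: clique_graph_def)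
  then show ?thesis by blast
qed

lemma cliques_edges_nonempty: "edges clique_graph \<noteq> {}"
  using simple_graph_cliques cliques_no_isolated
  by (auto simp: simple_graph_def hypergraph_def)

text \<open>Two disjoint edges inside one clique would need four vertices, so the edges of a
  matching lie in different cliques.\<close>

lemma card_matching_le:
  assumes "matching clique_graph M"
  shows "card M \<le> card I"
proof -
  have M: "card e = 2" "\<exists>i\<in>I. e \<subseteq> K i" if "e \<in> M" for e
    using assms that by (auto simp: matching_def clique_graph_def)
  then obtain c where c: "\<And>e. e \<in> M \<Longrightarrow> c e \<in> I \<and> e \<subseteq> K (c e)" by metis
  have "inj_on c M"
  proof (rule inj_onI, rule ccontr)
    fix e f assume ef: "e \<in> M" "f \<in> M" "c e = c f" "e \<noteq> f"
    then have "e \<inter> f = {}" using assms by (auto simp: matching_def disjoint_def)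
    moreover have "finite e" "finite f" using ef M by (metis card.infinite zero_neq_numeral)+
    ultimately have "card (e \<union> f) = 4" using M ef by (simp add: card_Un_disjoint)
    moreover have "card (e \<union> f) \<le> card (K (c e))"
      using c[of e] c[of f] ef finite_K by (intro card_mono) auto
    ultimately show False using card_K[of "c e"] c[of e] ef by auto
  qed
  then show ?thesis using c fin_I by (intro card_inj_on_le[of c]) auto
qed

text \<open>One edge \<open>{p i, q i}\<close> from each clique attains the upper bound.\<close>

lemma matching_number_cliques: "matching_number clique_graph = card I"
  unfolding matching_number_def
proof (rule Max_eqI)
  show "finite {card M |M. matching clique_graph M}"
    by (rule finite_subset[of _ "{..card I}"]) (use card_matching_le in auto)
  show "c \<le> card I" if "c \<in> {card M |M. matching clique_graph M}" for c
    using that card_matching_le by auto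
  obtain p q where pq: "\<And>i. i \<in> I \<Longrightarrow> p i \<noteq> q i \<and> p i \<in> K i \<and> q i \<in> K i"
    using ex_pair by metis
  define e where "e = (\<lambda>i. {p i, q i})"
  have e_disj: "e i \<inter> e j = {}" if "i \<in> I" "j \<in> I" "i \<noteq> j" for i j
  proof -
    have "K i \<inter> K j = {}" using disj that by (auto simp: disjoint_family_on_def)
    then show ?thesis using pq[OF that(1)] pq[OF that(2)] by (auto simp: e_def)
  qed
  have "matching clique_graph (e ` I)"
    unfolding matching_def
  proof
    show "e ` I \<subseteq> edges clique_graph"
      using pq by (auto simp: clique_graph_def e_def)
    show "disjoint (e ` I)"
      using e_disj unfolding disjoint_def by blast
  qed
  \<comment> \<open>If \<open>e i = e j\<close> with \<open>i \<noteq> j\<close>, this set would be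
    disjoint from itself, yet it contains \<open>p i\<close>.\<close>
  moreover have "inj_on e I"
    using e_disj by (intro inj_onI) (fastforce simp: e_def)
  then have "card (e ` I) = card I" by (rule card_image)
  ultimately show "card I \<in> {card M |M. matching clique_graph M}" by force
qed

text \<open>Lets covers be counted clique by clique, both for the cover that is constructed and for
  an arbitrary one.\<close>

lemma card_UN_sub:
  assumes "\<And>i. i \<in> I \<Longrightarrow> A i \<subseteq> K i"
  shows "card (\<Union>i\<in>I. A i) = (\<Sum>i\<in>I. card (A i))"
proof (rule card_UN_disjoint)
  show "\<forall>i\<in>I. finite (A i)" using assms finite_K by (meson finite_subset)
  show "\<forall>i\<in>I. \<forall>j\<in>I. i \<noteq> j \<longrightarrow> A i \<inter> A j = {}"
    using assms disj unfolding disjoint_family_on_def by blast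
qed (rule fin_I)

text \<open>Omitting a single vertex \<open>p i\<close> from each clique leaves a cover, as an edge
  has a second endpoint in the same clique.\<close>

lemma vertex_cover_cliques:
  obtains C where "vertex_cover clique_graph C" "card C = (\<Sum>i\<in>I. card (K i) - 1)"
proof -
  obtain p where p: "\<And>i. i \<in> I \<Longrightarrow> p i \<in> K i" using ex_pair by metis
  let ?C = "\<Union>i\<in>I. K i - {p i}"
  have "?C \<inter> e \<noteq> {}" if e: "e \<in> edges clique_graph" for e
  proof -
    from e obtain i where i: "i \<in> I" "e \<subseteq> K i" "card e = 2" by (auto simp: clique_graph_def)
    then obtain x where "x \<in> e" "x \<noteq> p i" by (metis card_2_iff insertCI)
    with i show ?thesis by blast
  qed
  then have "vertex_cover clique_graph ?C"
    by (auto simp: vertex_cover_def clique_graph_def)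
  moreover have "card ?C = (\<Sum>i\<in>I. card (K i - {p i}))"
    by (rule card_UN_sub) auto
  then have "card ?C = (\<Sum>i\<in>I. card (K i) - 1)" using p by simp
  ultimately show thesis by (rule that)
qed

text \<open>Two vertices of one clique outside \<open>C\<close> would span an uncovered edge, so
  \<open>C\<close> misses at most one vertex of each clique.\<close>

lemma card_vertex_cover_ge:
  assumes C: "vertex_cover clique_graph C"
  shows "(\<Sum>i\<in>I. card (K i) - 1) \<le> card C"
proof -
  have "card (K i) - 1 \<le> card (C \<inter> K i)" if i: "i \<in> I" for i
  proof -
    have "x = y" if "x \<in> K i - C" "y \<in> K i - C" for x y
    proof (rule ccontr)
      assume "x \<noteq> y"
      with that i have "{x, y} \<in> edges clique_graph" by (auto simp: clique_graph_def)
      with C that show False by (auto simp: vertex_cover_def)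
    qed
    then have "card (K i - C) \<le> 1"
      using finite_K i by (metis One_nat_def card_le_Suc0_iff_eq finite_Diff)
    moreover have "card (K i) = card (K i - C) + card (K i \<inter> C)"
      using card_Int_Diff[OF finite_K[OF i], of C] by simp
    ultimately show ?thesis by (simp add: Int_commute)
  qed
  then have "(\<Sum>i\<in>I. card (K i) - 1) \<le> (\<Sum>i\<in>I. card (C \<inter> K i))" by (rule sum_mono)
  also have "\<dots> = card (\<Union>i\<in>I. C \<inter> K i)" by (rule card_UN_sub[symmetric]) auto
  also have "(\<Union>i\<in>I. C \<inter> K i) = C"
    using C by (auto simp: vertex_cover_def clique_graph_def)
  finally show ?thesis .
qed

end

section \<open>Choice of the clique sizes\<close>

text \<open>An injection of the naturals, composed with \<open>prod_encode\<close>, lays out an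
  infinite grid in the type; \<open>K i\<close> consists of the first \<open>c i\<close> entries of
  row \<open>i\<close>.\<close>

lemma disjoint_family_with_cards:
  fixes c :: "nat \<Rightarrow> nat"
  obtains K :: "nat \<Rightarrow> 'a::infinite set" where "disjoint_family K" "\<And>i. card (K i) = c i"
proof -
  obtain f :: "nat \<Rightarrow> 'a" where f: "inj f"
    using infinite_UNIV infinite_countable_subset by blast
  define K where "K = (\<lambda>i. (\<lambda>j. f (prod_encode (i, j))) ` {..<c i})"
  have "disjoint_family K"
    by (auto simp: disjoint_family_on_def K_def inj_eq[OF f])
  moreover have "card (K i) = c i" for i
    unfolding K_def by (subst card_image) (auto simp: inj_on_def inj_eq[OF f])
  ultimately show thesis by (rule that)
qed

text \<open>The conjunct \<open>Gamma1 G \<noteq> {}\<close> keeps the universal claim from holding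
  vacuously.\<close>

theorem theorem5:
  fixes n m :: nat
  assumes "n \<ge> 2" and "m \<in> {n + 1..2 * n - 1}"
  shows "\<exists>G :: 'a::infinite hgraph. simple_graph G \<and> Gamma1 G \<noteq> {} \<and>
           (\<forall>H\<in>Gamma1 G. matching_number H = n \<and> domination_number H = m)"
proof -
  obtain K :: "nat \<Rightarrow> 'a set" where disjK: "disjoint_family K"
    and cardK: "\<And>i. card (K i) = (if i < m - n then 3 else 2)"
    using disjoint_family_with_cards[of "\<lambda>i. if i < m - n then 3 else 2"] by blast
  interpret cliques "{..<n}" K
    using disjK cardK \<open>n \<ge> 2\<close>
    by unfold_locales (auto simp: disjoint_family_on_def lessThan_empty_iff)
  \<comment> \<open>Every clique contributes 1 to the cover, and each of the \<open>m - n\<close>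
    triangles contributes 1 more.\<close>
  have "(\<Sum>i<n. card (K i) - 1) = (\<Sum>i<n. 1 + (if i < m - n then 1 else 0))"
    by (rule sum.cong) (auto simp: cardK)
  also have "\<dots> = n + card ({..<n} \<inter> {i. i < m - n})"
    by (subst sum.distrib) (simp add: sum.If_cases)
  \<comment> \<open>The bound \<open>m \<le> 2 * n - 1\<close> gives \<open>m - n < n\<close>, so
    all the triangles occur among the \<open>n\<close> cliques; \<open>n < m\<close> then makes
    \<open>n + (m - n)\<close> equal to \<open>m\<close> despite truncated subtraction.\<close>
  also have "{..<n} \<inter> {i. i < m - n} = {..<m - n}" using assms by auto
  finally have sum: "(\<Sum>i<n. card (K i) - 1) = m" using assms by simp
  obtain C where C: "vertex_cover clique_graph C" "card C = m"
    using vertex_cover_cliques sum by metis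
  show ?thesis
  proof (intro exI conjI ballI)
    show "simple_graph clique_graph" by (rule simple_graph_cliques)
    show "Gamma1 clique_graph \<noteq> {}"
      by (rule Gamma1_nonempty[OF simple_graph_cliques cliques_edges_nonempty])
    fix H assume "H \<in> Gamma1 clique_graph"
    then obtain k s S T where *: "dilation_via k clique_graph s S T H"
        "\<forall>e\<in>edges clique_graph. T e \<noteq> {}"
      by (auto simp: Gamma1_def)
    interpret dilation k clique_graph s S T H
      using simple_graph_cliques cliques_no_isolated * by unfold_locales auto
    show "matching_number H = n"
      using matching_number_eq matching_number_cliques by simp
    show "domination_number H = m"
      using domination_number_eq[OF C(1)] card_vertex_cover_ge C(2) sum by simp
  qed
qed

end
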